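(* Let $N\ge 1$ be an integer and $0<p<1$. Consider a particle on $\{0,1,\dots,N\}$ which, when at a position $x$ with $0<x<N$, moves to $x-1$ with probability $\frac{1-p}{2}$, to $x+1$ with probability $\frac{1-p}{2}$, or to $N-x$ with probability $p$, and which stops upon reaching $0$ or $N$. Let $g(x)$ be the expected number of steps until the particle started at $x$ reaches $0$ or $N$, i.e. the solution of \[ g(x)=\frac{1-p}{2}g(x-1)+\frac{1-p}{2}g(x+1)+p\,g(N-x)+1\quad (0<x<N),\qquad g(0)=g(N)=0. \] Then for $0\le x\le N$, \[ g(x)=\frac{1}{1-p}\,x(N-x). \]
   Context: The move from $x$ to $N-x$ is called the mirror step; this is the symmetric case where left and right unit steps have equal probability $\frac{1-p}{2}$. *)

theory Defs
  imports "HOL-Probability.Probability"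
begin

text \<open>
  One-step transition probabilities. The three contributions are added, so that coinciding
  targets (such as \<open>N - x = x + 1\<close>) accumulate their probabilities; for \<open>N - x = x\<close> the
  mirror step leaves the position unchanged but still counts as a step.
\<close>

definition mirror_kernel :: "nat \<Rightarrow> real \<Rightarrow> nat \<Rightarrow> nat \<Rightarrow> real" where
  "mirror_kernel N p x y =
     (if 0 < x \<and> x < N
      then (1 - p) / 2 * of_bool (y = x - 1) + (1 - p) / 2 * of_bool (y = x + 1)
           + p * of_bool (y = N - x)
      else of_bool (y = x))"

text \<open>
  \<open>X\<close> is a Markov chain with the above transition probabilities, started at \<open>x\<close>. The transition
  law is stated in product form, so conditioning on null events does not arise.
\<close>

definition mirror_walk ::
    "'a measure \<Rightarrow> nat \<Rightarrow> real \<Rightarrow> nat \<Rightarrow> (nat \<Rightarrow> 'a \<Rightarrow> nat) \<Rightarrow> bool" where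
  "mirror_walk M N p x X \<longleftrightarrow>
     prob_space M \<and>
     (\<forall>n. X n \<in> measurable M (count_space UNIV)) \<and>
     (AE \<omega> in M. X 0 \<omega> = x) \<and>
     (\<forall>n xs y. \<P>(\<omega> in M. (\<forall>i\<le>n. X i \<omega> = xs i) \<and> X (Suc n) \<omega> = y)
             = \<P>(\<omega> in M. \<forall>i\<le>n. X i \<omega> = xs i) * mirror_kernel N p (xs n) y)"

text \<open>The infimum is \<open>\<infinity>\<close> if neither \<open>0\<close> nor \<open>N\<close> is ever reached.\<close>

definition steps_to_boundary :: "nat \<Rightarrow> (nat \<Rightarrow> 'a \<Rightarrow> nat) \<Rightarrow> 'a \<Rightarrow> enat" where
  "steps_to_boundary N X \<omega> = (INF n\<in>{n. X n \<omega> = 0 \<or> X n \<omega> = N}. enat n)"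

definition expected_steps :: "'a measure \<Rightarrow> nat \<Rightarrow> (nat \<Rightarrow> 'a \<Rightarrow> nat) \<Rightarrow> ennreal" where
  "expected_steps M N X = (\<integral>\<^sup>+\<omega>. ennreal_of_enat (steps_to_boundary N X \<omega>) \<partial>M)"

definition mirror_equations :: "nat \<Rightarrow> real \<Rightarrow> (nat \<Rightarrow> real) \<Rightarrow> bool" where
  "mirror_equations N p g \<longleftrightarrow>
     (\<forall>x. 0 < x \<and> x < N \<longrightarrow>
        g x = (1 - p) / 2 * g (x - 1) + (1 - p) / 2 * g (x + 1) + p * g (N - x) + 1) \<and>
     g 0 = 0 \<and> g N = 0"

text \<open>
  Such chains exist: drive the particle by independent pairs of coin flips, the first deciding
  whether to mirror and the second choosing the direction of a unit step.
\<close>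

definition mirror_move :: "nat \<Rightarrow> nat \<Rightarrow> bool \<times> bool \<Rightarrow> nat" where
  "mirror_move N x t =
     (if 0 < x \<and> x < N then (if fst t then N - x else if snd t then x - 1 else x + 1) else x)"

primrec coin_walk :: "nat \<Rightarrow> nat \<Rightarrow> nat \<Rightarrow> (bool \<times> bool) stream \<Rightarrow> nat" where
  "coin_walk N 0 x s = x"
| "coin_walk N (Suc n) x s = coin_walk N n (mirror_move N x (shd s)) (stl s)"

definition coin_measure :: "real \<Rightarrow> (bool \<times> bool) measure" where
  "coin_measure p = measure_pmf (pair_pmf (bernoulli_pmf p) (bernoulli_pmf (1 / 2)))"

lemma measurable_coin_walk [measurable]:
  "coin_walk N n x \<in> measurable (stream_space (coin_measure p)) (count_space UNIV)"
proof (induction n arbitrary: x)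
  case 0
  then show ?case by simp
next
  case (Suc n)
  have [measurable]: "(\<lambda>s. coin_walk N n y (stl s))
      \<in> measurable (stream_space (coin_measure p)) (count_space UNIV)" for y
    using measurable_compose[OF measurable_stl Suc[of y]] .
  have [measurable]: "(\<lambda>s. mirror_move N x (shd s))
      \<in> measurable (stream_space (coin_measure p)) (count_space UNIV)"
    by (rule measurable_compose[OF measurable_shd]) (simp add: coin_measure_def)
  show ?case
    by simp
qed

lemma coin_measure_move:
  assumes "0 < p" "p < 1"
  shows "(\<integral>\<^sup>+t. ennreal (of_bool (y = mirror_move N x t)) \<partial>coin_measure p)
         = ennreal (mirror_kernel N p x y)"
proof -
  let ?D = "pair_pmf (bernoulli_pmf p) (bernoulli_pmf (1 / 2))"
  let ?f = "\<lambda>t. of_bool (y = mirror_move N x t) :: real"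
  have "(\<integral>t. ?f t \<partial>measure_pmf ?D)
      = (\<Sum>t\<in>{(True, True), (True, False), (False, True), (False, False)}. ?f t * pmf ?D t)"
    by (rule integral_measure_pmf_real) auto
  also have "\<dots> = mirror_kernel N p x y"
    using assms by (simp add: pmf_pair mirror_move_def mirror_kernel_def of_bool_def field_simps)
  finally have "(\<integral>t. ?f t \<partial>measure_pmf ?D) = mirror_kernel N p x y" .
  moreover have "(\<integral>\<^sup>+t. ennreal (?f t) \<partial>measure_pmf ?D) = ennreal (\<integral>t. ?f t \<partial>measure_pmf ?D)"
    by (intro nn_integral_eq_integral measure_pmf.integrable_const_bound[where B = 1]) auto
  ultimately show ?thesis
    by (simp add: coin_measure_def)
qed

lemma mirror_kernel_nonneg: "0 < p \<Longrightarrow> p < 1 \<Longrightarrow> 0 \<le> mirror_kernel N p x y"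
  by (simp add: mirror_kernel_def)

lemma coin_walk_path:
  assumes p: "0 < p" "p < 1"
  shows "\<P>(s in stream_space (coin_measure p). \<forall>i\<le>n. coin_walk N i x s = xs i)
         = of_bool (xs 0 = x) * (\<Prod>i<n. mirror_kernel N p (xs i) (xs (Suc i)))"
proof (induction n arbitrary: x xs)
  interpret C: prob_space "coin_measure p"
    unfolding coin_measure_def by (rule measure_pmf.prob_space_axioms)
  interpret S: prob_space "stream_space (coin_measure p)"
    by (rule C.prob_space_stream_space)
  {
    case 0
    then show ?case by (auto simp: S.prob_space)
  next
    case (Suc n)
    let ?S = "stream_space (coin_measure p)"
    let ?c = "\<Prod>i<n. mirror_kernel N p (xs (Suc i)) (xs (Suc (Suc i)))"
    have c: "0 \<le> ?c"
      using p by (intro prod_nonneg) (simp add: mirror_kernel_nonneg)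
    have all_Suc: "(\<forall>i\<le>Suc n. Q i) \<longleftrightarrow> Q 0 \<and> (\<forall>i\<le>n. Q (Suc i))" for Q
      by (metis Suc_le_mono le0 not0_implies_Suc)
    have step: "\<P>(s in ?S. \<forall>i\<le>Suc n. coin_walk N i x (t ## s) = xs i)
        = of_bool (xs 0 = x) * (of_bool (xs 1 = mirror_move N x t) * ?c)" for t
      using Suc[of "mirror_move N x t" "\<lambda>i. xs (Suc i)"]
      by (cases "xs 0 = x") (auto simp: all_Suc)
    have "ennreal (\<P>(s in ?S. \<forall>i\<le>Suc n. coin_walk N i x s = xs i))
        = (\<integral>\<^sup>+t. \<P>(s in ?S. \<forall>i\<le>Suc n. coin_walk N i x (t ## s) = xs i) \<partial>coin_measure p)"
      by (rule C.prob_stream_space) measurable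
    also have "\<dots> = (\<integral>\<^sup>+t. ennreal (of_bool (xs 0 = x) * ?c)
                         * ennreal (of_bool (xs 1 = mirror_move N x t)) \<partial>coin_measure p)"
      unfolding step using c by (intro nn_integral_cong) (auto simp: of_bool_def)
    also have "\<dots> = ennreal (of_bool (xs 0 = x) * ?c) * ennreal (mirror_kernel N p x (xs 1))"
      by (subst nn_integral_cmult) (simp_all add: coin_measure_move[OF p], simp add: coin_measure_def)
    also have "\<dots> = ennreal (of_bool (xs 0 = x) * ?c * mirror_kernel N p x (xs 1))"
      using c by (simp add: ennreal_mult mirror_kernel_nonneg[OF p])
    finally have "\<P>(s in ?S. \<forall>i\<le>Suc n. coin_walk N i x s = xs i)
        = of_bool (xs 0 = x) * ?c * mirror_kernel N p x (xs 1)"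
      using c by (subst (asm) ennreal_inj) (simp_all add: mirror_kernel_nonneg[OF p])
    then show ?case
      unfolding prod.lessThan_Suc_shift by (auto simp: mult_ac)
  }
qed

lemma mirror_walk_coin_walk:
  assumes p: "0 < p" "p < 1"
  shows "mirror_walk (stream_space (coin_measure p)) N p x (\<lambda>n. coin_walk N n x)"
  unfolding mirror_walk_def
proof (intro conjI allI)
  interpret C: prob_space "coin_measure p"
    unfolding coin_measure_def by (rule measure_pmf.prob_space_axioms)
  show "prob_space (stream_space (coin_measure p))"
    by (rule C.prob_space_stream_space)
  fix n :: nat and xs :: "nat \<Rightarrow> nat" and y :: nat
  let ?ys = "xs(Suc n := y)"
  have "((\<forall>i\<le>n. coin_walk N i x s = xs i) \<and> coin_walk N (Suc n) x s = y)
      \<longleftrightarrow> (\<forall>i\<le>Suc n. coin_walk N i x s = ?ys i)" for s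
    by (auto simp: le_Suc_eq simp del: coin_walk.simps)
  moreover have "(\<Prod>i<n. mirror_kernel N p (?ys i) (?ys (Suc i)))
      = (\<Prod>i<n. mirror_kernel N p (xs i) (xs (Suc i)))"
    by (rule prod.cong) auto
  ultimately show "\<P>(s in stream_space (coin_measure p).
        (\<forall>i\<le>n. coin_walk N i x s = xs i) \<and> coin_walk N (Suc n) x s = y)
      = \<P>(s in stream_space (coin_measure p). \<forall>i\<le>n. coin_walk N i x s = xs i)
        * mirror_kernel N p (xs n) y"
    by (simp only: coin_walk_path[OF p] prod.lessThan_Suc) simp
qed (use measurable_coin_walk in auto)

end

theory Submission
  imports Defs
begin

text \<open>
  Let \<open>g\<close> be a bounded function, zero outside a set \<open>D\<close> of states, whose mean drops by \<open>1\<close> in a step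
  from any state of \<open>D\<close>. Along a Markov chain killed on leaving \<open>D\<close>, the mean of \<open>g\<close> then drops in
  each step by the probability of being still alive. These probabilities therefore have bounded
  partial sums, so they tend to \<open>0\<close>; the mean of \<open>g\<close>, at most a constant multiple of them, tends to
  \<open>0\<close> as well, and the expected exit time, the sum of the survival probabilities, is the initial
  mean of \<open>g\<close>. For the mirror walk, \<open>x (N - x) / (1 - p)\<close> is such a \<open>g\<close>: the mirror step preserves
  it, and a unit step, taken with probability \<open>1 - p\<close>, lowers its mean by \<open>1 / (1 - p)\<close>.

  No sign of \<open>g\<close> is needed, so any two solutions of the linear system are the sum of the same
  survival probabilities, and uniqueness follows from the existence of the walk.
\<close>

section \<open>Laws of countably valued random variables\<close>

definition law_pmf :: "'a measure \<Rightarrow> ('a \<Rightarrow> 'b::countable) \<Rightarrow> 'b pmf" where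
  "law_pmf M Z = Abs_pmf (distr M (count_space UNIV) Z)"

context prob_space
begin

lemma measure_pmf_law_pmf:
  fixes Z :: "'a \<Rightarrow> 'b::countable"
  assumes Z: "Z \<in> measurable M (count_space UNIV)"
  shows "measure_pmf (law_pmf M Z) = distr M (count_space UNIV) Z"
proof -
  interpret Z: prob_space "distr M (count_space UNIV) Z"
    using Z by (rule prob_space_distr)
  have "AE z in distr M (count_space UNIV) Z. measure (distr M (count_space UNIV) Z) {z} \<noteq> 0"
    by (subst Z.AE_support_countable) (auto intro: exI[of _ UNIV])
  then show ?thesis
    unfolding law_pmf_def by (intro Abs_pmf_inverse) (simp add: Z.prob_space_axioms)
qed

lemma pmf_law_pmf:
  fixes Z :: "'a \<Rightarrow> 'b::countable"
  assumes [measurable]: "Z \<in> measurable M (count_space UNIV)"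
  shows "pmf (law_pmf M Z) z = \<P>(\<omega> in M. Z \<omega> = z)"
  by (simp add: pmf.rep_eq measure_pmf_law_pmf measure_distr vimage_def Int_def conj_commute)

lemma expectation_law_pmf:
  fixes Z :: "'a \<Rightarrow> 'b::countable" and f :: "'b \<Rightarrow> real"
  assumes [measurable]: "Z \<in> measurable M (count_space UNIV)"
  shows "measure_pmf.expectation (law_pmf M Z) f = expectation (\<lambda>\<omega>. f (Z \<omega>))"
  by (simp add: measure_pmf_law_pmf integral_distr)

lemma map_pmf_law_pmf:
  fixes Z :: "'a \<Rightarrow> 'b::countable" and h :: "'b \<Rightarrow> 'c::countable"
  assumes [measurable]: "Z \<in> measurable M (count_space UNIV)"
  shows "map_pmf h (law_pmf M Z) = law_pmf M (\<lambda>\<omega>. h (Z \<omega>))"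
  by (simp add: measure_pmf_inject[symmetric] map_pmf_rep_eq measure_pmf_law_pmf distr_distr o_def)

lemma AE_iff_set_law_pmf:
  fixes Z :: "'a \<Rightarrow> 'b::countable"
  assumes [measurable]: "Z \<in> measurable M (count_space UNIV)"
  shows "(AE \<omega> in M. Z \<omega> \<in> S) \<longleftrightarrow> set_pmf (law_pmf M Z) \<subseteq> S"
proof -
  have "(AE \<omega> in M. Z \<omega> \<in> S) \<longleftrightarrow> (AE z in measure_pmf (law_pmf M Z). z \<in> S)"
    unfolding measure_pmf_law_pmf[OF assms] by (subst AE_distr_iff) auto
  then show ?thesis
    by (auto simp: AE_measure_pmf_iff)
qed

end

lemma expectation_bind_pmf:
  fixes f :: "'b \<Rightarrow> real"
  assumes "\<And>y. \<bar>f y\<bar> \<le> C"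
  shows "measure_pmf.expectation (bind_pmf p q) f
    = measure_pmf.expectation p (\<lambda>x. measure_pmf.expectation (q x) f)"
  unfolding measure_pmf_bind
  by (rule integral_bind[where K = "count_space UNIV" and B = C and B' = 1])
    (use assms in \<open>auto simp: measure_pmf.emeasure_space_le_1 measure_pmf_in_subprob_algebra\<close>)

lemma pmf_bind_map_Pair:
  "pmf (bind_pmf p (\<lambda>x. map_pmf (Pair x) (q x))) (a, b) = pmf p a * pmf (q a) b"
proof -
  have "pmf (map_pmf (Pair x) (q x)) (a, b) = pmf (q a) b * indicator {a} x" for x
    by (auto simp: pmf_map_inj' inj_def intro!: pmf_map_outside split: split_indicator)
  then show ?thesis
    by (simp add: pmf_bind pmf.rep_eq[of p])
qed

section \<open>Hitting times\<close>

definition hitting_time :: "'s set \<Rightarrow> (nat \<Rightarrow> 'a \<Rightarrow> 's) \<Rightarrow> 'a \<Rightarrow> enat" where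
  "hitting_time A X \<omega> = (INF n\<in>{n. X n \<omega> \<in> A}. enat n)"

lemma less_hitting_time_iff: "enat n < hitting_time A X \<omega> \<longleftrightarrow> (\<forall>i\<le>n. X i \<omega> \<notin> A)"
proof -
  have "enat n < hitting_time A X \<omega> \<longleftrightarrow> enat (Suc n) \<le> hitting_time A X \<omega>"
    by (simp add: Suc_ile_eq)
  also have "\<dots> \<longleftrightarrow> (\<forall>i. X i \<omega> \<in> A \<longrightarrow> Suc n \<le> i)"
    by (auto simp: hitting_time_def le_INF_iff)
  also have "\<dots> \<longleftrightarrow> (\<forall>i\<le>n. X i \<omega> \<notin> A)"
    by (metis not_less_eq_eq)
  finally show ?thesis .
qed

lemma hitting_time_eq_Least:
  "hitting_time A X \<omega> = (if \<exists>n. X n \<omega> \<in> A then enat (LEAST n. X n \<omega> \<in> A) else \<infinity>)"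
proof (cases "\<exists>n. X n \<omega> \<in> A")
  case True
  then have "hitting_time A X \<omega> = enat (LEAST n. X n \<omega> \<in> A)"
    unfolding hitting_time_def
    by (intro antisym INF_lower INF_greatest) (auto intro: LeastI Least_le)
  with True show ?thesis
    by simp
qed (simp add: hitting_time_def top_enat_def)

lemma measurable_hitting_time [measurable]:
  assumes [measurable]: "\<And>n. X n \<in> measurable M (count_space UNIV)"
  shows "hitting_time A X \<in> measurable M (count_space UNIV)"
proof -
  have [measurable]: "Measurable.pred M (\<lambda>\<omega>. X n \<omega> \<in> A)" for n
    by (rule measurable_compose[OF assms]) simp
  show ?thesis
    unfolding hitting_time_eq_Least[abs_def] by measurable
qed

lemma (in prob_space) nn_integral_hitting_time:
  assumes [measurable]: "\<And>n. X n \<in> measurable M (count_space UNIV)"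
  shows "(\<integral>\<^sup>+\<omega>. ennreal_of_enat (hitting_time A X \<omega>) \<partial>M)
    = (\<Sum>n. ennreal (\<P>(\<omega> in M. \<forall>i\<le>n. X i \<omega> \<notin> A)))"
  by (simp add: nn_integral_enat_function less_hitting_time_iff emeasure_eq_measure)

section \<open>Exit times of Markov chains\<close>

lemma sums_decrements:
  fixes e u :: "nat \<Rightarrow> real"
  assumes decrement: "\<And>n. e (Suc n) = e n - u n"
    and e_le: "\<And>n. \<bar>e n\<bar> \<le> C * u n" and u: "\<And>n. 0 \<le> u n" "\<And>n. u n \<le> B"
  shows "u sums e 0"
proof -
  have partial_sum: "(\<Sum>k<n. u k) = e 0 - e n" for n
    by (induction n) (simp_all add: decrement)
  have e_bounded: "\<bar>e n\<bar> \<le> \<bar>C\<bar> * B" for n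
    using e_le[of n] mult_mono[OF abs_ge_self[of C] u(2)[of n] abs_ge_zero u(1)] by simp
  have "summable u"
  proof (rule summableI_nonneg_bounded)
    show "(\<Sum>k<n. u k) \<le> \<bar>C\<bar> * B + \<bar>C\<bar> * B" for n
      unfolding partial_sum using e_bounded[of 0] e_bounded[of n] by linarith
  qed (rule u)
  then have "(\<lambda>n. C * u n) \<longlonglongrightarrow> 0"
    by (intro tendsto_mult_right_zero summable_LIMSEQ_zero)
  then have "e \<longlonglongrightarrow> 0"
    by (rule Lim_null_comparison[rotated]) (simp add: e_le)
  then have "(\<lambda>n. e 0 - e n) \<longlonglongrightarrow> e 0 - 0"
    by (intro tendsto_intros)
  then show ?thesis
    by (simp add: sums_def partial_sum)
qed

definition trajectory :: "(nat \<Rightarrow> 'a \<Rightarrow> 's) \<Rightarrow> nat \<Rightarrow> 'a \<Rightarrow> 's list" where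
  "trajectory X n \<omega> = map (\<lambda>i. X i \<omega>) [0..<Suc n]"

lemma trajectory_eq_iff:
  "trajectory X n \<omega> = xs \<longleftrightarrow> length xs = Suc n \<and> (\<forall>i\<le>n. X i \<omega> = xs ! i)"
  by (auto simp: trajectory_def list_eq_iff_nth_eq less_Suc_eq_le simp del: upt_Suc)

lemma last_trajectory [simp]: "last (trajectory X n \<omega>) = X n \<omega>"
  by (simp add: trajectory_def)

lemma set_trajectory_subset_iff: "set (trajectory X n \<omega>) \<subseteq> D \<longleftrightarrow> (\<forall>i\<le>n. X i \<omega> \<in> D)"
  by (auto simp: trajectory_def less_Suc_eq_le simp del: upt_Suc)

lemma measurable_trajectory [measurable]:
  fixes X :: "nat \<Rightarrow> 'a \<Rightarrow> 's::countable"
  assumes [measurable]: "\<And>n. X n \<in> measurable M (count_space UNIV)"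
  shows "trajectory X n \<in> measurable M (count_space UNIV)"
  unfolding measurable_count_space_eq2_countable
proof (intro conjI ballI)
  fix xs
  have "trajectory X n -` {xs} \<inter> space M
      = {\<omega> \<in> space M. length xs = Suc n \<and> (\<forall>i\<le>n. X i \<omega> = xs ! i)}"
    by (simp only: vimage_def Int_def mem_Collect_eq singleton_iff trajectory_eq_iff conj_commute)
  also have "\<dots> \<in> sets M"
    by measurable
  finally show "trajectory X n -` {xs} \<inter> space M \<in> sets M" .
qed auto

definition poisson_solution :: "('s \<Rightarrow> 's pmf) \<Rightarrow> 's set \<Rightarrow> ('s \<Rightarrow> real) \<Rightarrow> bool" where
  "poisson_solution K D g \<longleftrightarrow>
     (\<forall>a\<in>D. g a = measure_pmf.expectation (K a) g + 1) \<and> (\<forall>a. a \<notin> D \<longrightarrow> g a = 0)"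

locale discrete_markov_chain = prob_space M for M :: "'a measure" +
  fixes K :: "'s::countable \<Rightarrow> 's pmf" and X :: "nat \<Rightarrow> 'a \<Rightarrow> 's"
  assumes measurable_chain [measurable]: "\<And>n. X n \<in> measurable M (count_space UNIV)"
    and prob_trajectory_Suc: "\<And>n xs y. \<P>(\<omega> in M. (\<forall>i\<le>n. X i \<omega> = xs i) \<and> X (Suc n) \<omega> = y)
      = \<P>(\<omega> in M. \<forall>i\<le>n. X i \<omega> = xs i) * pmf (K (xs n)) y"
begin

lemma law_pmf_trajectory_Suc:
  "law_pmf M (\<lambda>\<omega>. (trajectory X n \<omega>, X (Suc n) \<omega>))
    = bind_pmf (law_pmf M (trajectory X n)) (\<lambda>xs. map_pmf (Pair xs) (K (last xs)))"
    (is "?joint = ?bind")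
proof (rule pmf_eqI, clarify)
  fix xs y
  have "\<P>(\<omega> in M. trajectory X n \<omega> = xs \<and> X (Suc n) \<omega> = y)
      = \<P>(\<omega> in M. trajectory X n \<omega> = xs) * pmf (K (last xs)) y"
  proof (cases "length xs = Suc n")
    case True
    then have "last xs = xs ! n"
      by (metis diff_Suc_1 last_conv_nth length_0_conv nat.distinct(1))
    with True show ?thesis
      by (simp add: trajectory_eq_iff prob_trajectory_Suc)
  next
    case False
    then show ?thesis
      by (simp add: trajectory_eq_iff)
  qed
  then show "pmf ?joint (xs, y) = pmf ?bind (xs, y)"
    by (simp add: pmf_bind_map_Pair pmf_law_pmf)
qed

lemma law_pmf_chain_Suc: "law_pmf M (X (Suc n)) = bind_pmf (law_pmf M (X n)) K"
proof -
  have "law_pmf M (X (Suc n)) = map_pmf snd (law_pmf M (\<lambda>\<omega>. (trajectory X n \<omega>, X (Suc n) \<omega>)))"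
    by (simp add: map_pmf_law_pmf)
  also have "\<dots> = bind_pmf (map_pmf last (law_pmf M (trajectory X n))) K"
    by (simp add: law_pmf_trajectory_Suc map_bind_pmf bind_map_pmf map_pmf_comp)
  finally show ?thesis
    by (simp add: map_pmf_law_pmf)
qed

lemma AE_chain_in_closed_set:
  assumes start: "AE \<omega> in M. X 0 \<omega> \<in> S" and closed: "\<And>a. a \<in> S \<Longrightarrow> set_pmf (K a) \<subseteq> S"
  shows "AE \<omega> in M. \<forall>n. X n \<omega> \<in> S"
proof -
  have "set_pmf (law_pmf M (X n)) \<subseteq> S" for n
  proof (induction n)
    case 0
    show ?case
      using start by (simp add: AE_iff_set_law_pmf)
  next
    case (Suc n)
    with closed show ?case
      by (auto simp: law_pmf_chain_Suc)
  qed
  then show ?thesis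
    by (simp add: AE_all_countable AE_iff_set_law_pmf)
qed

lemma expectation_trajectory_Suc:
  fixes \<phi> :: "'s list \<Rightarrow> real" and g :: "'s \<Rightarrow> real"
  assumes \<phi>: "\<And>xs. \<bar>\<phi> xs\<bar> \<le> B" and g: "\<And>a. \<bar>g a\<bar> \<le> C"
  shows "expectation (\<lambda>\<omega>. \<phi> (trajectory X n \<omega>) * g (X (Suc n) \<omega>))
    = expectation (\<lambda>\<omega>. \<phi> (trajectory X n \<omega>) * measure_pmf.expectation (K (X n \<omega>)) g)"
proof -
  let ?f = "\<lambda>(xs, y). \<phi> xs * g y"
  have bounded: "\<bar>?f z\<bar> \<le> B * C" for z
    using mult_mono[OF \<phi> g] order_trans[OF abs_ge_zero \<phi>]
    by (auto simp: abs_mult split: prod.split)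
  have "expectation (\<lambda>\<omega>. \<phi> (trajectory X n \<omega>) * g (X (Suc n) \<omega>))
      = measure_pmf.expectation (law_pmf M (\<lambda>\<omega>. (trajectory X n \<omega>, X (Suc n) \<omega>))) ?f"
    by (simp add: expectation_law_pmf)
  also have "\<dots> = measure_pmf.expectation (law_pmf M (trajectory X n))
      (\<lambda>xs. \<phi> xs * measure_pmf.expectation (K (last xs)) g)"
    by (simp add: law_pmf_trajectory_Suc expectation_bind_pmf[OF bounded])
  finally show ?thesis
    by (simp add: expectation_law_pmf)
qed

definition survival_prob :: "'s set \<Rightarrow> nat \<Rightarrow> real" where
  "survival_prob D n = \<P>(\<omega> in M. \<forall>i\<le>n. X i \<omega> \<in> D)"

definition killed_expectation :: "'s set \<Rightarrow> ('s \<Rightarrow> real) \<Rightarrow> nat \<Rightarrow> real" where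
  "killed_expectation D g n = expectation (\<lambda>\<omega>. of_bool (\<forall>i\<le>n. X i \<omega> \<in> D) * g (X n \<omega>))"

lemma integrable_killed_chain:
  fixes g :: "'s \<Rightarrow> real"
  assumes bounded: "\<And>a. \<bar>g a\<bar> \<le> C"
  shows "integrable M (\<lambda>\<omega>. of_bool (\<forall>i\<le>n. X i \<omega> \<in> D) * g (X n \<omega>))"
  by (rule integrable_const_bound[where B = C])
    (use bounded order_trans[OF abs_ge_zero bounded] in auto)

lemma killed_expectation_const: "killed_expectation D (\<lambda>_. c) n = c * survival_prob D n"
proof -
  have "killed_expectation D (\<lambda>_. c) n
      = expectation (\<lambda>\<omega>. c * indicator {\<omega>\<in>space M. \<forall>i\<le>n. X i \<omega> \<in> D} \<omega>)"
    unfolding killed_expectation_def by (intro Bochner_Integration.integral_cong) auto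
  then show ?thesis
    by (simp add: survival_prob_def)
qed

lemma killed_expectation_diff:
  assumes f: "\<And>a. \<bar>f a\<bar> \<le> B" and g: "\<And>a. \<bar>g a\<bar> \<le> C"
  shows "killed_expectation D (\<lambda>a. f a - g a) n
    = killed_expectation D f n - killed_expectation D g n"
  unfolding killed_expectation_def right_diff_distrib
  by (intro Bochner_Integration.integral_diff
      integrable_killed_chain[OF f] integrable_killed_chain[OF g])

lemma killed_expectation_cong:
  assumes "\<And>a. a \<in> D \<Longrightarrow> f a = g a"
  shows "killed_expectation D f n = killed_expectation D g n"
  unfolding killed_expectation_def using assms by (intro Bochner_Integration.integral_cong) auto

lemma abs_killed_expectation_le:
  assumes bounded: "\<And>a. \<bar>g a\<bar> \<le> C"
  shows "\<bar>killed_expectation D g n\<bar> \<le> C * survival_prob D n"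
proof -
  have "\<bar>killed_expectation D g n\<bar> \<le> killed_expectation D (\<lambda>a. \<bar>g a\<bar>) n"
    unfolding killed_expectation_def
    by (rule order_trans[OF integral_abs_bound]) (simp add: abs_mult)
  also have "\<dots> \<le> killed_expectation D (\<lambda>_. C) n"
    unfolding killed_expectation_def
    by (intro integral_mono integrable_killed_chain[where C = "\<bar>C\<bar>"] mult_left_mono bounded)
      (use order_trans[OF bounded abs_ge_self] in auto)
  finally show ?thesis
    by (simp add: killed_expectation_const)
qed

lemma killed_expectation_0:
  assumes "\<And>a. a \<notin> D \<Longrightarrow> g a = 0"
  shows "killed_expectation D g 0 = expectation (\<lambda>\<omega>. g (X 0 \<omega>))"
  unfolding killed_expectation_def using assms
  by (intro Bochner_Integration.integral_cong) auto

lemma killed_expectation_Suc: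
  assumes bounded: "\<And>a. \<bar>g a\<bar> \<le> C" and outside: "\<And>a. a \<notin> D \<Longrightarrow> g a = 0"
  shows "killed_expectation D g (Suc n)
    = killed_expectation D (\<lambda>a. measure_pmf.expectation (K a) g) n"
proof -
  have "killed_expectation D g (Suc n)
      = expectation (\<lambda>\<omega>. of_bool (set (trajectory X n \<omega>) \<subseteq> D) * g (X (Suc n) \<omega>))"
    unfolding killed_expectation_def
    by (intro Bochner_Integration.integral_cong)
      (auto simp: set_trajectory_subset_iff le_Suc_eq outside)
  also have "\<dots> = expectation (\<lambda>\<omega>. of_bool (set (trajectory X n \<omega>) \<subseteq> D)
      * measure_pmf.expectation (K (X n \<omega>)) g)"
    by (rule expectation_trajectory_Suc[where B = 1]) (auto intro: bounded)
  finally show ?thesis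
    by (simp add: killed_expectation_def set_trajectory_subset_iff)
qed

lemma survival_prob_sums:
  assumes bounded: "\<And>a. \<bar>g a\<bar> \<le> C" and g: "poisson_solution K D g"
  shows "survival_prob D sums expectation (\<lambda>\<omega>. g (X 0 \<omega>))"
proof -
  have outside: "g a = 0" if "a \<notin> D" for a
    using g that by (simp add: poisson_solution_def)
  have "killed_expectation D g (Suc n) = killed_expectation D g n - survival_prob D n" for n
  proof -
    have "killed_expectation D g (Suc n)
        = killed_expectation D (\<lambda>a. measure_pmf.expectation (K a) g) n"
      using bounded outside by (rule killed_expectation_Suc)
    also have "\<dots> = killed_expectation D (\<lambda>a. g a - 1) n"
      using g by (intro killed_expectation_cong) (simp add: poisson_solution_def)
    also have "\<dots> = killed_expectation D g n - survival_prob D n"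
      using killed_expectation_diff[of g C "\<lambda>_. 1" 1] bounded
      by (simp add: killed_expectation_const)
    finally show ?thesis .
  qed
  then have "survival_prob D sums killed_expectation D g 0"
    by (rule sums_decrements[where B = 1, OF _ abs_killed_expectation_le[OF bounded]])
      (simp_all add: survival_prob_def)
  then show ?thesis
    by (simp add: killed_expectation_0 outside)
qed

lemma expected_exit_time:
  assumes bounded: "\<And>a. \<bar>g a\<bar> \<le> C" and g: "poisson_solution K D g"
  shows "(\<integral>\<^sup>+\<omega>. ennreal_of_enat (hitting_time (- D) X \<omega>) \<partial>M)
    = ennreal (expectation (\<lambda>\<omega>. g (X 0 \<omega>)))"
proof -
  have "(\<integral>\<^sup>+\<omega>. ennreal_of_enat (hitting_time (- D) X \<omega>) \<partial>M)
      = (\<Sum>n. ennreal (survival_prob D n))"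
    by (simp add: nn_integral_hitting_time survival_prob_def)
  also have "\<dots> = ennreal (expectation (\<lambda>\<omega>. g (X 0 \<omega>)))"
    by (rule suminf_ennreal_eq[OF _ survival_prob_sums[OF assms]]) (simp add: survival_prob_def)
  finally show ?thesis .
qed

end

section \<open>The mirror walk\<close>

definition mirror_step :: "nat \<Rightarrow> real \<Rightarrow> nat \<Rightarrow> nat pmf" where
  "mirror_step N p x
    = map_pmf (mirror_move N x) (pair_pmf (bernoulli_pmf p) (bernoulli_pmf (1 / 2)))"

lemma pmf_mirror_step:
  assumes "0 < p" "p < 1"
  shows "pmf (mirror_step N p x) y = mirror_kernel N p x y"
proof -
  have "ennreal (pmf (mirror_step N p x) y)
      = (\<integral>\<^sup>+t. ennreal (of_bool (y = mirror_move N x t)) \<partial>coin_measure p)"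
    unfolding mirror_step_def ennreal_pmf_map coin_measure_def
    by (auto simp: nn_integral_indicator[symmetric] simp del: nn_integral_indicator
        intro!: nn_integral_cong split: split_indicator)
  then show ?thesis
    by (simp add: coin_measure_move[OF assms] mirror_kernel_nonneg[OF assms])
qed

lemma expectation_mirror_step:
  assumes p: "0 < p" "p < 1" and x: "0 < x" "x < N"
  shows "measure_pmf.expectation (mirror_step N p x) g
    = (1 - p) / 2 * g (x - 1) + (1 - p) / 2 * g (x + 1) + p * g (N - x)"
proof -
  have "measure_pmf.expectation (mirror_step N p x) g
      = (\<Sum>t\<in>{(True, True), (True, False), (False, True), (False, False)}.
          g (mirror_move N x t) * pmf (pair_pmf (bernoulli_pmf p) (bernoulli_pmf (1 / 2))) t)"
    unfolding mirror_step_def integral_map_pmf by (rule integral_measure_pmf_real) auto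
  then show ?thesis
    using p x by (simp add: pmf_pair mirror_move_def field_simps)
qed

lemma set_mirror_step_subset: "x \<le> N \<Longrightarrow> set_pmf (mirror_step N p x) \<subseteq> {..N}"
  by (auto simp: mirror_step_def mirror_move_def)

lemma discrete_markov_chain_mirror_walk:
  assumes "0 < p" "p < 1" "mirror_walk M N p x X"
  shows "discrete_markov_chain M (mirror_step N p) X"
  using assms
  by (simp add: mirror_walk_def discrete_markov_chain_def discrete_markov_chain_axioms_def
      pmf_mirror_step)

lemma mirror_walk_expectation_start:
  fixes g :: "nat \<Rightarrow> real"
  assumes "mirror_walk M N p x X"
  shows "(\<integral>\<omega>. g (X 0 \<omega>) \<partial>M) = g x"
proof -
  interpret prob_space M
    using assms by (simp add: mirror_walk_def)
  have [measurable]: "X 0 \<in> measurable M (count_space UNIV)"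
    using assms by (simp add: mirror_walk_def)
  have "(\<integral>\<omega>. g (X 0 \<omega>) \<partial>M) = (\<integral>\<omega>. g x \<partial>M)"
    using assms by (intro integral_cong_AE) (auto simp: mirror_walk_def)
  then show ?thesis
    by (simp add: prob_space)
qed

lemma AE_mirror_walk_le:
  assumes p: "0 < p" "p < 1" and X: "mirror_walk M N p x X" and "x \<le> N"
  shows "AE \<omega> in M. \<forall>n. X n \<omega> \<le> N"
proof -
  interpret discrete_markov_chain M "mirror_step N p" X
    using p X by (rule discrete_markov_chain_mirror_walk)
  have "AE \<omega> in M. X 0 \<omega> \<in> {..N}"
    using X \<open>x \<le> N\<close> by (auto simp: mirror_walk_def)
  then have "AE \<omega> in M. \<forall>n. X n \<omega> \<in> {..N}"
    by (rule AE_chain_in_closed_set) (auto dest: subsetD[OF set_mirror_step_subset])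
  then show ?thesis
    by simp
qed

lemma expected_steps_eq_exit_time:
  assumes "0 < p" "p < 1" "mirror_walk M N p x X" "x \<le> N"
  shows "expected_steps M N X = (\<integral>\<^sup>+\<omega>. ennreal_of_enat (hitting_time (- {0<..<N}) X \<omega>) \<partial>M)"
  unfolding expected_steps_def
proof (rule nn_integral_cong_AE)
  show "AE \<omega> in M. ennreal_of_enat (steps_to_boundary N X \<omega>)
      = ennreal_of_enat (hitting_time (- {0<..<N}) X \<omega>)"
    using AE_mirror_walk_le[OF assms]
  proof eventually_elim
    case (elim \<omega>)
    then have "{n. X n \<omega> = 0 \<or> X n \<omega> = N} = {n. X n \<omega> \<in> - {0<..<N}}"
      by (auto simp: not_less intro: antisym)
    then show ?case
      by (simp only: steps_to_boundary_def hitting_time_def)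
  qed
qed

lemma poisson_solution_if_mirror_equations:
  assumes p: "0 < p" "p < 1" and g: "mirror_equations N p g"
  obtains h C where "poisson_solution (mirror_step N p) {0<..<N} h"
    and "\<And>a. \<bar>h a\<bar> \<le> C" and "\<And>a. a \<le> N \<Longrightarrow> h a = g a"
proof
  define h where "h a = (if a \<le> N then g a else 0)" for a
  show "poisson_solution (mirror_step N p) {0<..<N} h"
    unfolding poisson_solution_def
  proof (intro conjI ballI allI impI)
    fix a assume "a \<in> {0<..<N}"
    then have a: "0 < a" "a < N"
      by auto
    then have "g a = (1 - p) / 2 * g (a - 1) + (1 - p) / 2 * g (a + 1) + p * g (N - a) + 1"
      using g unfolding mirror_equations_def by blast
    also have "\<dots> = measure_pmf.expectation (mirror_step N p a) h + 1"
      unfolding expectation_mirror_step[OF p a] using a by (simp add: h_def)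
    finally show "h a = measure_pmf.expectation (mirror_step N p a) h + 1"
      using a by (simp add: h_def)
  next
    fix a assume "a \<notin> {0<..<N}"
    then show "h a = 0"
      using g by (cases "a = 0 \<or> a = N") (auto simp: mirror_equations_def h_def)
  qed
  show "\<bar>h a\<bar> \<le> (\<Sum>b\<le>N. \<bar>g b\<bar>)" for a
    using member_le_sum[of a "{..N}" "\<lambda>b. \<bar>g b\<bar>"] by (simp add: h_def sum_nonneg)
  show "h a = g a" if "a \<le> N" for a
    using that by (simp add: h_def)
qed

lemma expected_steps_eq_solution:
  assumes p: "0 < p" "p < 1" and X: "mirror_walk M N p x X" and x: "x \<le> N"
    and g: "mirror_equations N p g"
  shows "expected_steps M N X = ennreal (g x)"
proof -
  interpret discrete_markov_chain M "mirror_step N p" X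
    using p X by (rule discrete_markov_chain_mirror_walk)
  obtain h C where h: "poisson_solution (mirror_step N p) {0<..<N} h" "\<And>a. \<bar>h a\<bar> \<le> C"
    and h_eq: "\<And>a. a \<le> N \<Longrightarrow> h a = g a"
    using poisson_solution_if_mirror_equations[OF p g] by blast
  have "expected_steps M N X = ennreal (expectation (\<lambda>\<omega>. h (X 0 \<omega>)))"
    using expected_exit_time[OF h(2,1)] by (simp only: expected_steps_eq_exit_time[OF p X x])
  then show ?thesis
    using h_eq[OF x] by (simp only: mirror_walk_expectation_start[OF X])
qed

lemma mirror_equations_unique:
  assumes p: "0 < p" "p < 1" and f: "mirror_equations N p f" and g: "mirror_equations N p g"
    and x: "x \<le> N"
  shows "f x = g x"
proof -
  let ?M = "stream_space (coin_measure p)" and ?X = "\<lambda>n. coin_walk N n x"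
  have X: "mirror_walk ?M N p x ?X"
    using p by (rule mirror_walk_coin_walk)
  interpret discrete_markov_chain ?M "mirror_step N p" ?X
    using p X by (rule discrete_markov_chain_mirror_walk)
  have survival_sums: "survival_prob {0<..<N} sums e x" if e: "mirror_equations N p e" for e
  proof -
    obtain h C where h: "poisson_solution (mirror_step N p) {0<..<N} h" "\<And>a. \<bar>h a\<bar> \<le> C"
      and h_eq: "\<And>a. a \<le> N \<Longrightarrow> h a = e a"
      using poisson_solution_if_mirror_equations[OF p e] by blast
    show ?thesis
      using survival_prob_sums[OF h(2,1)] h_eq[OF x]
      by (simp only: mirror_walk_expectation_start[OF X])
  qed
  show ?thesis
    using survival_sums[OF f] survival_sums[OF g] by (rule sums_unique2)
qed

definition mirror_solution :: "nat \<Rightarrow> real \<Rightarrow> nat \<Rightarrow> real" where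
  "mirror_solution N p x = 1 / (1 - p) * real x * (real N - real x)"

lemma mirror_equations_mirror_solution:
  assumes "p < 1"
  shows "mirror_equations N p (mirror_solution N p)"
  unfolding mirror_equations_def
proof (intro conjI allI impI)
  fix x assume x: "0 < x \<and> x < N"
  have scaled: "(1 - p) * mirror_solution N p y = real y * (real N - real y)" for y
    using assms by (simp add: mirror_solution_def)
  have "(1 - p) * mirror_solution N p (x - 1) + (1 - p) * mirror_solution N p (x + 1)
      = 2 * ((1 - p) * mirror_solution N p x) - 2"
    unfolding scaled using x by (simp add: of_nat_diff algebra_simps)
  moreover have "mirror_solution N p (N - x) = mirror_solution N p x"
    using x by (simp add: mirror_solution_def of_nat_diff)
  ultimately show "mirror_solution N p x = (1 - p) / 2 * mirror_solution N p (x - 1)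
      + (1 - p) / 2 * mirror_solution N p (x + 1) + p * mirror_solution N p (N - x) + 1"
    by (simp add: field_simps)
qed (simp_all add: mirror_solution_def)

theorem mainTheorem4:
  fixes N :: nat and p :: real and M :: "'a measure"
  assumes "N \<ge> 1" and "0 < p" and "p < 1"
  shows "(\<forall>x X. x \<le> N \<longrightarrow> mirror_walk M N p x X \<longrightarrow>
            expected_steps M N X = ennreal (1 / (1 - p) * real x * (real N - real x)))
       \<and> (\<forall>g. mirror_equations N p g \<longrightarrow>
            (\<forall>x\<le>N. g x = 1 / (1 - p) * real x * (real N - real x)))"
proof -
  have solution: "mirror_equations N p (mirror_solution N p)"
    using \<open>p < 1\<close> by (rule mirror_equations_mirror_solution)
  have "expected_steps M N X = ennreal (mirror_solution N p x)"
    if "x \<le> N" "mirror_walk M N p x X" for x X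
    using expected_steps_eq_solution[OF assms(2,3) that(2,1) solution] .
  moreover have "g x = mirror_solution N p x" if "mirror_equations N p g" "x \<le> N" for g x
    using mirror_equations_unique[OF assms(2,3) that(1) solution that(2)] .
  ultimately show ?thesis
    by (simp add: mirror_solution_def)
qed

end
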